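(* Let $\mu/\alpha$ and $\nu/\beta$ be skew Young diagrams, and let $t\ge 0$ and $N\ge 0$ be integers. Then $$\Omega_{\mathbf q}(\mu/\alpha\vee\nu/\beta,t)\cdot\Omega_{\mathbf q}(\mu/\alpha\wedge\nu/\beta,t)\ \geqslant_{\mathbf q}\ \Omega_{\mathbf q}(\mu/\alpha,t)\cdot\Omega_{\mathbf q}(\nu/\beta,t)$$ and $$\mathcal F_{\mu/\alpha\vee\nu/\beta}(\mathbf z)\cdot\mathcal F_{\mu/\alpha\wedge\nu/\beta}(\mathbf z)\ \geqslant_{\mathbf z}\ \mathcal F_{\mu/\alpha}(\mathbf z)\cdot\mathcal F_{\nu/\beta}(\mathbf z),$$ where $\mathbf z=(z_0,z_1,\dots,z_N)$, $\mu/\alpha\vee\nu/\beta:=(\mu\vee\nu)/(\alpha\vee\beta)$ and $\mu/\alpha\wedge\nu/\beta:=(\mu\wedge\nu)/(\alpha\wedge\beta)$.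
   Context: A partition $\lambda=(\lambda_1\ge\lambda_2\ge\dots)$ is identified with its Young diagram $\{(i,j): 1\le j\le\lambda_i\}$. If $\tau\subseteq\lambda$ are Young diagrams, the skew Young diagram $\lambda/\tau$ is the set difference $\lambda\setminus\tau$. For Young diagrams, $\vee$ and $\wedge$ denote the union and the intersection of the diagrams. For an integer $s\ge 0$, $\mathrm{RPP}(\lambda/\tau,s)$ is the set of maps $T:\lambda/\tau\to\{0,1,\dots,s\}$ (reverse plane partitions) such that $T(i,j)\le T(i',j')$ for all squares $(i,j),(i',j')\in\lambda/\tau$ with $i\le i'$ and $j\le j'$. The variables $\mathbf q=(q_{(i,j)})$ are indexed by the squares $(i,j)$ of $\mu\vee\nu$, and for a skew shape $\lambda/\tau$ contained in $\mu\vee\nu$, $$\Omega_{\mathbf q}(\lambda/\tau,t):=\sum_{T\in\mathrm{RPP}(\lambda/\tau,t)}\ \prod_{(i,j)\in\lambda/\tau}q_{(i,j)}^{T(i,j)},$$ $$\mathcal F_{\lambda/\tau}(z_0,\dots,z_N):=\sum_{T\in\mathrm{RPP}(\lambda/\tau,N)}z_0^{m_0(T)}\cdots z_N^{m_N(T)},\qquad m_i(T):=|T^{-1}(i)|.$$ The relation $F\geqslant_{\mathbf q}G$ (respectively $F\geqslant_{\mathbf z}G$) means that all coefficients of $F-G$ as a polynomial in $\mathbf q$ (respectively $\mathbf z$) are nonnegative. *)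

theory Defs
  imports Main "HOL-Library.Poly_Mapping" "HOL-Library.FuncSet"
begin

text \<open>A partition is a finitely supported, weakly decreasing sequence indexed from 1;
  the value at index 0 is irrelevant.\<close>

definition is_partition :: "(nat \<Rightarrow> nat) \<Rightarrow> bool" where
  "is_partition l \<longleftrightarrow> finite {i. 1 \<le> i \<and> l i \<noteq> 0} \<and> (\<forall>i j. 1 \<le> i \<and> i \<le> j \<longrightarrow> l j \<le> l i)"

definition diagram :: "(nat \<Rightarrow> nat) \<Rightarrow> (nat \<times> nat) set" where
  "diagram l = {(i, j). 1 \<le> i \<and> 1 \<le> j \<and> j \<le> l i}"

definition young_diagram :: "(nat \<times> nat) set \<Rightarrow> bool" where
  "young_diagram D \<longleftrightarrow> (\<exists>l. is_partition l \<and> D = diagram l)"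

text \<open>\<^term>\<open>skew_diagram mu alpha\<close> says that mu/alpha is a skew Young diagram. Its set of
  squares is \<^term>\<open>mu - alpha\<close>; the pair is kept because join and meet of skew diagrams
  depend on mu and alpha, not only on the set difference.\<close>

definition skew_diagram :: "(nat \<times> nat) set \<Rightarrow> (nat \<times> nat) set \<Rightarrow> bool" where
  "skew_diagram mu alpha \<longleftrightarrow> young_diagram mu \<and> young_diagram alpha \<and> alpha \<subseteq> mu"

text \<open>Maps defined on a set \<open>S\<close> of squares are represented extensionally
  (\<^const>\<open>undefined\<close> outside \<open>S\<close>), so that each is counted once.\<close>

definition RPP :: "(nat \<times> nat) set \<Rightarrow> nat \<Rightarrow> (nat \<times> nat \<Rightarrow> nat) set" where
  "RPP S s = {T \<in> S \<rightarrow>\<^sub>E {0..s}.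
     \<forall>i j i' j'. (i, j) \<in> S \<and> (i', j') \<in> S \<and> i \<le> i' \<and> j \<le> j' \<longrightarrow> T (i, j) \<le> T (i', j')}"

text \<open>Integer polynomials in variables indexed by \<open>'x\<close>: finitely supported maps from
  monomials (finitely supported exponent vectors) to coefficients, multiplied by convolution.\<close>

type_synonym 'x mpoly_int = "('x \<Rightarrow>\<^sub>0 nat) \<Rightarrow>\<^sub>0 int"

definition var :: "'x \<Rightarrow> 'x mpoly_int" where
  "var x = Poly_Mapping.single (Poly_Mapping.single x 1) 1"

definition coeff_ge :: "'x mpoly_int \<Rightarrow> 'x mpoly_int \<Rightarrow> bool" where
  "coeff_ge F G \<longleftrightarrow> (\<forall>m. 0 \<le> Poly_Mapping.lookup (F - G) m)"

text \<open>All squares index variables here; only the variables of squares in \<open>S\<close> occur.\<close>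

definition Omega :: "(nat \<times> nat) set \<Rightarrow> nat \<Rightarrow> (nat \<times> nat) mpoly_int" where
  "Omega S t = (\<Sum>T\<in>RPP S t. \<Prod>x\<in>S. var x ^ T x)"

definition mult_of :: "(nat \<times> nat) set \<Rightarrow> (nat \<times> nat \<Rightarrow> nat) \<Rightarrow> nat \<Rightarrow> nat" where
  "mult_of S T i = card {x \<in> S. T x = i}"

definition F_poly :: "(nat \<times> nat) set \<Rightarrow> nat \<Rightarrow> nat mpoly_int" where
  "F_poly S N = (\<Sum>T\<in>RPP S N. \<Prod>i=0..N. var i ^ mult_of S T i)"

end

theory Submission
  imports Defs
begin

text \<open>
  Extend a reverse plane partition of \<open>mu/alpha\<close> to all of \<open>X = mu \<union> nu\<close> by a least value on
  \<open>alpha\<close> and a greatest value off \<open>mu\<close>. Reverse plane partitions of \<open>mu/alpha\<close> become exactly the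
  monotone labelings of \<open>X\<close> that take the least value on \<open>alpha\<close> and the greatest value off \<open>mu\<close>.
  For labelings \<open>f\<close> and \<open>g\<close> that belong to \<open>mu/alpha\<close> and \<open>nu/beta\<close>, the pointwise minimum belongs
  to the join of the two skew shapes and the pointwise maximum to the meet. Replacing \<open>(f, g)\<close> by
  \<open>(min, max)\<close> only permutes the two values at each square, so it preserves every weight that is a
  product over squares; both the \<open>q\<close>-weight and the \<open>z\<close>-weight are of this kind. However, this map
  is not injective.

  Injectivity is restored inside each fibre. Fix \<open>u \<le> v\<close> and consider the pairs \<open>(f, g)\<close> with
  minimum \<open>u\<close> and maximum \<open>v\<close>, where \<open>u\<close> and \<open>v\<close> are monotone. Such a pair amounts to the set \<open>C\<close>
  of squares with \<open>u < v\<close> at which \<open>f\<close> takes the larger value, and \<open>f\<close> and \<open>g\<close> are both monotone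
  precisely if any two squares \<open>x \<le> y\<close> with \<open>u x < v x\<close>, \<open>u y < v y\<close> and \<open>v x > u y\<close> are both
  in \<open>C\<close> or both outside it. This condition is stable under symmetric
  difference. Choose one pair in the fibre, with set \<open>C0\<close>, and send \<open>C\<close> to the symmetric
  difference of \<open>C\<close> and \<open>C0\<close>: this is injective and yields monotone pairs. At a square where the
  shapes determine which of \<open>f\<close> and \<open>g\<close> is larger, \<open>C\<close> and \<open>C0\<close> agree, so the new pair has the
  minimum in front there, as the join and the meet require. The lemma
  \<open>swap_injection\<close> carries out this argument, and \<open>coeff_ge_sum_inj\<close> turns a weight-preserving
  injection into an inequality of coefficients.
\<close>

section \<open>Monotone labelings and the swapping injection\<close>

text \<open>The values \<open>0\<close> and \<open>k\<close> play the roles of minus and plus infinity: they mark the squares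
  inside the inner shape \<open>L\<close> and outside the outer shape \<open>U\<close>.\<close>

definition labelings :: "'a set \<Rightarrow> ('a \<Rightarrow> 'a \<Rightarrow> bool) \<Rightarrow> nat \<Rightarrow> 'a set \<Rightarrow> 'a set \<Rightarrow> ('a \<Rightarrow> nat) set"
  where
  "labelings X le k U L = {f \<in> X \<rightarrow>\<^sub>E {0..k}.
     (\<forall>x\<in>X. \<forall>y\<in>X. le x y \<longrightarrow> f x \<le> f y) \<and>
     (\<forall>x\<in>X. (f x = 0 \<longleftrightarrow> x \<in> L) \<and> (f x = k \<longleftrightarrow> x \<notin> U))}"

lemma finite_labelings: "finite X \<Longrightarrow> finite (labelings X le k U L)"
  unfolding labelings_def by (simp add: finite_PiE)

definition lo :: "('a \<Rightarrow> nat) \<times> ('a \<Rightarrow> nat) \<Rightarrow> 'a \<Rightarrow> nat" where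
  "lo p x = min (fst p x) (snd p x)"

definition hi :: "('a \<Rightarrow> nat) \<times> ('a \<Rightarrow> nat) \<Rightarrow> 'a \<Rightarrow> nat" where
  "hi p x = max (fst p x) (snd p x)"

text \<open>Suppose that \<open>p\<close> and \<open>r\<close> have the same minimum and the same maximum. If \<open>C\<close> and \<open>C0\<close> are
  the sets of points where minimum and maximum differ and the first component of \<open>p\<close>,
  respectively \<open>r\<close>, takes the larger value, then the first component of \<open>swap X r p\<close> takes the
  larger value exactly on the symmetric difference of \<open>C\<close> and \<open>C0\<close>.\<close>

definition swap :: "'a set \<Rightarrow> ('a \<Rightarrow> nat) \<times> ('a \<Rightarrow> nat) \<Rightarrow> ('a \<Rightarrow> nat) \<times> ('a \<Rightarrow> nat) \<Rightarrow>
    ('a \<Rightarrow> nat) \<times> ('a \<Rightarrow> nat)" where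
  "swap X r p =
    ((\<lambda>x\<in>X. if fst p x = fst r x then lo p x else hi p x),
     (\<lambda>x\<in>X. if fst p x = fst r x then hi p x else lo p x))"

lemma same_lo_hi_cases:
  assumes "lo p x = lo r x" "hi p x = hi r x"
  shows "(fst p x = fst r x \<and> snd p x = snd r x) \<or> (fst p x = snd r x \<and> snd p x = fst r x)"
  using assms unfolding lo_def hi_def by linarith

text \<open>Where \<open>p\<close> and \<open>r\<close> agree at exactly one of two comparable points, each value of \<open>p\<close> at the
  lower point is at most both values at the upper point: one bound comes from \<open>p\<close>, the other
  from \<open>r\<close>. Hence any arrangement of the values is monotone there.\<close>

lemma swap_mono:
  fixes p r :: "('a \<Rightarrow> nat) \<times> ('a \<Rightarrow> nat)"
  assumes xy: "x \<in> X" "y \<in> X"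
    and p: "fst p x \<le> fst p y" "snd p x \<le> snd p y"
    and r: "fst r x \<le> fst r y" "snd r x \<le> snd r y"
    and fibre: "lo p x = lo r x" "hi p x = hi r x" "lo p y = lo r y" "hi p y = hi r y"
  shows "fst (swap X r p) x \<le> fst (swap X r p) y \<and> snd (swap X r p) x \<le> snd (swap X r p) y"
proof -
  have "lo p x \<le> lo p y" "hi p x \<le> hi p y"
    using p unfolding lo_def hi_def by auto
  moreover have "hi p x \<le> lo p y" if "(fst p x = fst r x) \<noteq> (fst p y = fst r y)"
    using same_lo_hi_cases[OF fibre(1,2)] same_lo_hi_cases[OF fibre(3,4)] p r that
    unfolding lo_def hi_def by auto
  moreover have "lo p x \<le> hi p x" "lo p y \<le> hi p y"
    unfolding lo_def hi_def by auto
  ultimately show ?thesis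
    using xy unfolding swap_def by auto
qed

lemma swap_lo_hi:
  assumes "x \<in> X"
  shows "lo (swap X r p) x = lo p x" "hi (swap X r p) x = hi p x"
  using assms unfolding swap_def lo_def hi_def by auto

text \<open>The shapes of \<open>p\<close> and \<open>r\<close> coincide, so at a point where one component of \<open>p\<close> has an extreme
  value, \<open>p\<close> and \<open>r\<close> agree, and the swapped pair has its minimum in front.\<close>

lemma swap_in_labelings:
  assumes p: "p \<in> labelings X le k U L \<times> labelings X le k U' L'"
    and r: "r \<in> labelings X le k U L \<times> labelings X le k U' L'"
    and fibre: "\<And>x. x \<in> X \<Longrightarrow> lo p x = lo r x \<and> hi p x = hi r x"
  shows "swap X r p \<in> labelings X le k (U \<union> U') (L \<union> L') \<times> labelings X le k (U \<inter> U') (L \<inter> L')"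
proof -
  let ?f = "fst (swap X r p)" and ?g = "snd (swap X r p)"
  have P: "fst p x \<le> k" "snd p x \<le> k" "fst p x = 0 \<longleftrightarrow> x \<in> L" "fst p x = k \<longleftrightarrow> x \<notin> U"
      "snd p x = 0 \<longleftrightarrow> x \<in> L'" "snd p x = k \<longleftrightarrow> x \<notin> U'" if "x \<in> X" for x
    using p that unfolding labelings_def mem_Times_iff by auto
  have R: "fst r x = 0 \<longleftrightarrow> x \<in> L" "fst r x = k \<longleftrightarrow> x \<notin> U"
      "snd r x = 0 \<longleftrightarrow> x \<in> L'" "snd r x = k \<longleftrightarrow> x \<notin> U'" if "x \<in> X" for x
    using r that unfolding labelings_def mem_Times_iff by auto
  have mono: "?f x \<le> ?f y \<and> ?g x \<le> ?g y" if "x \<in> X" "y \<in> X" "le x y" for x y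
  proof (rule swap_mono[OF that(1,2)])
    show "fst p x \<le> fst p y" "snd p x \<le> snd p y" "fst r x \<le> fst r y" "snd r x \<le> snd r y"
      using p r that unfolding labelings_def mem_Times_iff by auto
  qed (use fibre that in auto)
  have shape: "?f x \<le> k \<and> ?g x \<le> k \<and> (?f x = 0 \<longleftrightarrow> x \<in> L \<union> L') \<and> (?f x = k \<longleftrightarrow> x \<notin> U \<union> U') \<and>
      (?g x = 0 \<longleftrightarrow> x \<in> L \<inter> L') \<and> (?g x = k \<longleftrightarrow> x \<notin> U \<inter> U')" if x: "x \<in> X" for x
  proof (cases "fst p x = fst r x")
    case True
    then show ?thesis
      using P[OF x] x unfolding swap_def lo_def hi_def by (auto simp: min_def max_def)
  next
    case False
    have cross: "fst p x = snd r x" "snd p x = fst r x"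
      using same_lo_hi_cases[of p x r] fibre[OF x] False by auto
    have "x \<notin> L" "x \<in> U" "x \<notin> L'" "x \<in> U'"
      using False cross P[OF x] R[OF x] by metis+
    then show ?thesis
      using False P[OF x] x unfolding swap_def lo_def hi_def by (auto simp: min_def max_def)
  qed
  have ext: "?f \<in> extensional X" "?g \<in> extensional X"
    unfolding swap_def by auto
  show ?thesis
    using mono shape ext unfolding labelings_def mem_Times_iff PiE_def by auto
qed

lemma swap_inj_on_fibre:
  assumes ext: "fst p \<in> extensional X" "snd p \<in> extensional X"
      "fst p' \<in> extensional X" "snd p' \<in> extensional X"
    and fibre: "\<And>x. x \<in> X \<Longrightarrow> lo p x = lo r x \<and> hi p x = hi r x"
    and fibre': "\<And>x. x \<in> X \<Longrightarrow> lo p' x = lo r x \<and> hi p' x = hi r x"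
    and eq: "swap X r p = swap X r p'"
  shows "p = p'"
proof -
  have "fst p x = fst p' x \<and> snd p x = snd p' x" if x: "x \<in> X" for x
  proof -
    have "fst (swap X r p) x = fst (swap X r p') x" using eq by simp
    then show ?thesis
      using x fibre[OF x] fibre'[OF x] same_lo_hi_cases[of p x r] same_lo_hi_cases[of p' x r]
      unfolding swap_def lo_def hi_def by (auto split: if_splits)
  qed
  then have "fst p = fst p'" "snd p = snd p'"
    using ext by (auto intro: extensionalityI)
  then show ?thesis by (simp add: prod_eq_iff)
qed

text \<open>The reference pair of each fibre is an arbitrary element of that fibre. Swapping keeps the
  pointwise minimum and maximum, so the fibre, hence its reference pair, can be read off the image.\<close>

lemma swap_injection:
  fixes X :: "'a set" and le :: "'a \<Rightarrow> 'a \<Rightarrow> bool" and k :: nat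
  defines "A \<equiv> \<lambda>U L U' L'. labelings X le k U L \<times> labelings X le k U' L'"
  obtains \<phi> where
    "inj_on \<phi> (A U L U' L')"
    "\<phi> ` A U L U' L' \<subseteq> A (U \<union> U') (L \<union> L') (U \<inter> U') (L \<inter> L')"
    "\<forall>p\<in>A U L U' L'. \<forall>x\<in>X. lo (\<phi> p) x = lo p x \<and> hi (\<phi> p) x = hi p x"
proof -
  define key :: "('a \<Rightarrow> nat) \<times> ('a \<Rightarrow> nat) \<Rightarrow> ('a \<Rightarrow> nat) \<times> ('a \<Rightarrow> nat)"
    where "key p = (restrict (lo p) X, restrict (hi p) X)" for p
  define rep where "rep p = (SOME r. r \<in> A U L U' L' \<and> key r = key p)" for p
  define \<phi> where "\<phi> p = swap X (rep p) p" for p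
  have rep: "rep p \<in> A U L U' L' \<and> key (rep p) = key p" if "p \<in> A U L U' L'" for p
    unfolding rep_def by (rule someI[of _ p]) (use that in auto)
  have keyD: "lo p x = lo r x \<and> hi p x = hi r x" if "key p = key r" "x \<in> X" for p r x
  proof -
    have "restrict (lo p) X x = restrict (lo r) X x" "restrict (hi p) X x = restrict (hi r) X x"
      using that(1) unfolding key_def by simp_all
    then show ?thesis using that(2) by simp
  qed
  have fibre: "lo p x = lo (rep p) x \<and> hi p x = hi (rep p) x" if "p \<in> A U L U' L'" "x \<in> X" for p x
    using keyD rep that by metis
  have lohi: "lo (\<phi> p) x = lo p x \<and> hi (\<phi> p) x = hi p x" if "x \<in> X" for p x
    unfolding \<phi>_def using swap_lo_hi that by metis
  have key_\<phi>: "key (\<phi> p) = key p" for p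
    unfolding key_def using lohi by (auto simp: restrict_def fun_eq_iff)
  have "inj_on \<phi> (A U L U' L')"
  proof (rule inj_onI)
    fix p p' assume p: "p \<in> A U L U' L'" "p' \<in> A U L U' L'" and eq: "\<phi> p = \<phi> p'"
    have "key p = key p'" using key_\<phi> eq by metis
    then have rep_eq: "rep p' = rep p" unfolding rep_def by simp
    show "p = p'"
    proof (rule swap_inj_on_fibre[where X = X and r = "rep p"])
      show "swap X (rep p) p = swap X (rep p) p'" using eq rep_eq unfolding \<phi>_def by simp
    qed (use p fibre[OF p(1)] fibre[OF p(2)] rep_eq in
          \<open>auto simp: A_def labelings_def mem_Times_iff PiE_def\<close>)
  qed
  moreover have "\<phi> ` A U L U' L' \<subseteq> A (U \<union> U') (L \<union> L') (U \<inter> U') (L \<inter> L')"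
  proof
    fix y assume "y \<in> \<phi> ` A U L U' L'"
    then obtain p where p: "p \<in> A U L U' L'" and y: "y = \<phi> p" by blast
    show "y \<in> A (U \<union> U') (L \<union> L') (U \<inter> U') (L \<inter> L')"
      unfolding y \<phi>_def A_def
      by (rule swap_in_labelings) (use p rep[OF p] fibre[OF p] in \<open>auto simp: A_def\<close>)
  qed
  ultimately show ?thesis using that lohi by blast
qed

section \<open>Reverse plane partitions as labelings\<close>

definition cell_le :: "nat \<times> nat \<Rightarrow> nat \<times> nat \<Rightarrow> bool" where
  "cell_le x y \<longleftrightarrow> fst x \<le> fst y \<and> snd x \<le> snd y"

definition down_closed_in :: "(nat \<times> nat) set \<Rightarrow> (nat \<times> nat) set \<Rightarrow> bool" where
  "down_closed_in X D \<longleftrightarrow> (\<forall>x\<in>X. \<forall>y\<in>D. cell_le x y \<longrightarrow> x \<in> D)"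

lemma RPP_iff_cell_le:
  "T \<in> RPP S s \<longleftrightarrow> T \<in> S \<rightarrow>\<^sub>E {0..s} \<and> (\<forall>x\<in>S. \<forall>y\<in>S. cell_le x y \<longrightarrow> T x \<le> T y)"
  unfolding RPP_def cell_le_def by auto

text \<open>The values \<open>0..s\<close> of a reverse plane partition are shifted to \<open>1..s+1\<close>, which frees \<open>0\<close>
  and \<open>s+2\<close> for the two extreme values.\<close>

definition extend :: "(nat \<times> nat) set \<Rightarrow> nat \<Rightarrow> (nat \<times> nat) set \<Rightarrow> (nat \<times> nat) set \<Rightarrow>
    (nat \<times> nat \<Rightarrow> nat) \<Rightarrow> nat \<times> nat \<Rightarrow> nat" where
  "extend X s U L T = (\<lambda>x\<in>X. if x \<in> L then 0 else if x \<in> U then T x + 1 else s + 2)"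

lemma bij_betw_extend:
  assumes "L \<subseteq> U" "U \<subseteq> X" and down: "down_closed_in X U" "down_closed_in X L"
  shows "bij_betw (extend X s U L) (RPP (U - L) s) (labelings X cell_le (s + 2) U L)"
proof (rule bij_betwI[where g = "\<lambda>f. \<lambda>x\<in>U - L. f x - 1"])
  show "extend X s U L \<in> RPP (U - L) s \<rightarrow> labelings X cell_le (s + 2) U L"
  proof
    fix T assume T: "T \<in> RPP (U - L) s"
    have bound: "T x \<le> s" if "x \<in> U - L" for x
      using T that unfolding RPP_iff_cell_le by (meson PiE_mem atLeastAtMost_iff)
    have mono: "extend X s U L T x \<le> extend X s U L T y" if "x \<in> X" "y \<in> X" "cell_le x y" for x y
    proof -
      have "y \<in> U \<Longrightarrow> x \<in> U" "y \<in> L \<Longrightarrow> x \<in> L"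
        using down that unfolding down_closed_in_def by blast+
      moreover have "T x \<le> T y" if "x \<in> U - L" "y \<in> U - L"
        using T \<open>cell_le x y\<close> that unfolding RPP_iff_cell_le by blast
      moreover have "x \<in> U - L \<Longrightarrow> T x \<le> s" by (rule bound)
      ultimately show ?thesis
        using that assms(1) unfolding extend_def by auto
    qed
    have "extend X s U L T x \<le> s + 2 \<and> (extend X s U L T x = 0 \<longleftrightarrow> x \<in> L) \<and>
        (extend X s U L T x = s + 2 \<longleftrightarrow> x \<notin> U)" if "x \<in> X" for x
      using that assms(1) bound[of x] unfolding extend_def by auto
    moreover have "extend X s U L T \<in> extensional X"
      unfolding extend_def by simp
    ultimately show "extend X s U L T \<in> labelings X cell_le (s + 2) U L"
      using mono unfolding labelings_def PiE_def by auto
  qed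
  show "(\<lambda>f. \<lambda>x\<in>U - L. f x - 1) \<in> labelings X cell_le (s + 2) U L \<rightarrow> RPP (U - L) s"
  proof
    fix f assume f: "f \<in> labelings X cell_le (s + 2) U L"
    have "f x - 1 \<le> s" if "x \<in> U - L" for x
    proof -
      have "x \<in> X" using that assms by blast
      then have "f x \<le> s + 2" "f x \<noteq> s + 2" using f that unfolding labelings_def by auto
      then show ?thesis by simp
    qed
    moreover have "f x - 1 \<le> f y - 1" if "x \<in> U - L" "y \<in> U - L" "cell_le x y" for x y
    proof -
      have "x \<in> X" "y \<in> X" using that assms by blast+
      then have "f x \<le> f y" using f that unfolding labelings_def by blast
      then show ?thesis by simp
    qed
    ultimately show "(\<lambda>x\<in>U - L. f x - 1) \<in> RPP (U - L) s"
      unfolding RPP_iff_cell_le by auto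
  qed
  show "(\<lambda>x\<in>U - L. extend X s U L T x - 1) = T" if "T \<in> RPP (U - L) s" for T
  proof
    fix x show "(\<lambda>x\<in>U - L. extend X s U L T x - 1) x = T x"
    proof (cases "x \<in> U - L")
      case True
      then show ?thesis using assms(2) unfolding extend_def by auto
    next
      case False
      have "T \<in> extensional (U - L)" using that unfolding RPP_iff_cell_le PiE_def by blast
      then have "T x = undefined" using False unfolding extensional_def by blast
      then show ?thesis using False by (simp only: restrict_apply if_False)
    qed
  qed
  show "extend X s U L (\<lambda>x\<in>U - L. f x - 1) = f" if f: "f \<in> labelings X cell_le (s + 2) U L" for f
  proof
    fix x show "extend X s U L (\<lambda>x\<in>U - L. f x - 1) x = f x"
    proof (cases "x \<in> X")
      case True
      then show ?thesis using f unfolding labelings_def extend_def by (auto simp: Suc_le_eq)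
    next
      case False
      have "f \<in> extensional X" using f unfolding labelings_def PiE_def by blast
      then have "f x = undefined" using False unfolding extensional_def by blast
      then show ?thesis using False unfolding extend_def by simp
    qed
  qed
qed

definition extend_weight :: "nat \<Rightarrow> ('a \<Rightarrow> nat \<Rightarrow> 'b::one) \<Rightarrow> 'a \<Rightarrow> nat \<Rightarrow> 'b" where
  "extend_weight s w x v = (if v = 0 \<or> v = s + 2 then 1 else w x (v - 1))"

lemma prod_extend:
  fixes w :: "nat \<times> nat \<Rightarrow> nat \<Rightarrow> 'b::comm_monoid_mult"
  assumes "finite X" "L \<subseteq> U" "U \<subseteq> X" and T: "T \<in> RPP (U - L) s"
  shows "(\<Prod>x\<in>X. extend_weight s w x (extend X s U L T x)) = (\<Prod>x\<in>U - L. w x (T x))"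
proof -
  have bound: "T x \<le> s" if "x \<in> U - L" for x
    using T that unfolding RPP_iff_cell_le by (meson PiE_mem atLeastAtMost_iff)
  show ?thesis
  proof (rule prod.mono_neutral_cong_right)
    show "\<forall>x\<in>X - (U - L). extend_weight s w x (extend X s U L T x) = 1"
      unfolding extend_weight_def extend_def by auto
    show "extend_weight s w x (extend X s U L T x) = w x (T x)" if "x \<in> U - L" for x
      using bound[OF that] that assms unfolding extend_weight_def extend_def by auto
  qed (use assms in auto)
qed

lemma sum_RPP_eq_sum_labelings:
  fixes w :: "nat \<times> nat \<Rightarrow> nat \<Rightarrow> 'b::comm_semiring_1"
  assumes "finite X" "L \<subseteq> U" "U \<subseteq> X" "down_closed_in X U" "down_closed_in X L"
  shows "(\<Sum>T\<in>RPP (U - L) s. \<Prod>x\<in>U - L. w x (T x)) =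
    (\<Sum>f\<in>labelings X cell_le (s + 2) U L. \<Prod>x\<in>X. extend_weight s w x (f x))"
  using sum.reindex_bij_betw[OF bij_betw_extend[OF assms(2-5)],
      of "\<lambda>f. \<Prod>x\<in>X. extend_weight s w x (f x)" s, symmetric]
  by (simp add: prod_extend[OF assms(1-3)])

section \<open>Comparison of polynomials by injections\<close>

definition monomial :: "'x mpoly_int \<Rightarrow> bool" where
  "monomial p \<longleftrightarrow> (\<exists>m. p = Poly_Mapping.single m 1)"

lemma monomial_one: "monomial 1"
  unfolding monomial_def by (metis single_one)

lemma monomial_mult: "monomial p \<Longrightarrow> monomial q \<Longrightarrow> monomial (p * q)"
  unfolding monomial_def by (auto simp: mult_single)

lemma monomial_prod: "(\<And>x. x \<in> S \<Longrightarrow> monomial (f x)) \<Longrightarrow> monomial (prod f S)"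
  by (induction S rule: infinite_finite_induct) (auto simp: monomial_one monomial_mult)

lemma monomial_var: "monomial (var x)"
  unfolding monomial_def var_def by blast

lemma monomial_var_power: "monomial (var x ^ n)"
  by (induction n) (auto simp: monomial_one monomial_mult monomial_var)

lemma coeff_ge_sum_inj:
  fixes W :: "'a \<Rightarrow> 'x mpoly_int"
  assumes "finite A" "inj_on \<phi> B" "\<phi> ` B \<subseteq> A"
    and W: "\<And>p. p \<in> A \<Longrightarrow> monomial (W p)"
    and V: "\<And>p. p \<in> B \<Longrightarrow> W (\<phi> p) = V p"
  shows "coeff_ge (\<Sum>p\<in>A. W p) (\<Sum>p\<in>B. V p)"
proof -
  have "(\<Sum>p\<in>B. V p) = (\<Sum>p\<in>\<phi> ` B. W p)"
    using assms(2) V by (simp add: sum.reindex)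
  then have diff: "(\<Sum>p\<in>A. W p) - (\<Sum>p\<in>B. V p) = (\<Sum>p\<in>A - \<phi> ` B. W p)"
    using sum_diff[OF assms(1,3), of W] by simp
  have "0 \<le> Poly_Mapping.lookup (W p) m" if "p \<in> A" for p m
    using W[OF that] unfolding monomial_def by (auto simp: lookup_single when_def)
  then show ?thesis
    unfolding coeff_ge_def diff by (auto simp: lookup_sum intro!: sum_nonneg)
qed

lemma F_poly_eq_sum_prod:
  assumes "finite S"
  shows "F_poly S N = (\<Sum>T\<in>RPP S N. \<Prod>x\<in>S. var (T x))"
  unfolding F_poly_def
proof (rule sum.cong)
  fix T assume T: "T \<in> RPP S N"
  then have "T ` S \<subseteq> {0..N}" unfolding RPP_def by auto
  from prod.group[OF assms _ this, of "\<lambda>x. var (T x)"]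
  show "(\<Prod>i=0..N. var i ^ mult_of S T i) = (\<Prod>x\<in>S. var (T x))"
    by (simp add: mult_of_def)
qed simp

text \<open>The inequality for an arbitrary weight that is a product over squares; \<open>Omega\<close> and \<open>F_poly\<close>
  come from the weights \<open>var x ^ v\<close> and \<open>var v\<close>.\<close>

lemma coeff_ge_RPP_join_meet:
  fixes w :: "nat \<times> nat \<Rightarrow> nat \<Rightarrow> 'x mpoly_int" and s :: nat
  assumes fin: "finite (mu \<union> nu)" and sub: "alpha \<subseteq> mu" "beta \<subseteq> nu"
    and down: "down_closed_in (mu \<union> nu) mu" "down_closed_in (mu \<union> nu) alpha"
      "down_closed_in (mu \<union> nu) nu" "down_closed_in (mu \<union> nu) beta"
    and w: "\<And>x v. monomial (w x v)"
  defines "G \<equiv> \<lambda>S. \<Sum>T\<in>RPP S s. \<Prod>x\<in>S. w x (T x)"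
  shows "coeff_ge
    (G ((mu \<union> nu) - (alpha \<union> beta)) * G ((mu \<inter> nu) - (alpha \<inter> beta)))
    (G (mu - alpha) * G (nu - beta))"
proof -
  define X where "X = mu \<union> nu"
  define lab where "lab = labelings X cell_le (s + 2)"
  define e where "e = extend_weight s w"
  define W where "W p = (\<Prod>x\<in>X. e x (fst p x) * e x (snd p x))"
    for p :: "(nat \<times> nat \<Rightarrow> nat) \<times> (nat \<times> nat \<Rightarrow> nat)"
  have G: "G (U - L) * G (U' - L') = (\<Sum>p\<in>lab U L \<times> lab U' L'. W p)"
    if "L \<subseteq> U" "U \<subseteq> X" "down_closed_in X U" "down_closed_in X L"
      "L' \<subseteq> U'" "U' \<subseteq> X" "down_closed_in X U'" "down_closed_in X L'" for U L U' L'
  proof -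
    have "G (U - L) = (\<Sum>f\<in>lab U L. \<Prod>x\<in>X. e x (f x))"
        "G (U' - L') = (\<Sum>f\<in>lab U' L'. \<Prod>x\<in>X. e x (f x))"
      unfolding G_def lab_def e_def
      by (rule sum_RPP_eq_sum_labelings; use fin that in \<open>simp add: X_def\<close>)+
    then show ?thesis
      by (simp add: W_def sum_product sum.cartesian_product prod.distrib case_prod_unfold)
  qed
  obtain \<phi> where \<phi>: "inj_on \<phi> (lab mu alpha \<times> lab nu beta)"
      "\<phi> ` (lab mu alpha \<times> lab nu beta)
        \<subseteq> lab (mu \<union> nu) (alpha \<union> beta) \<times> lab (mu \<inter> nu) (alpha \<inter> beta)"
      "\<forall>p\<in>lab mu alpha \<times> lab nu beta. \<forall>x\<in>X. lo (\<phi> p) x = lo p x \<and> hi (\<phi> p) x = hi p x"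
    by (rule swap_injection[where X = X and le = cell_le and k = "s + 2"
          and U = mu and L = alpha and U' = nu and L' = beta, folded lab_def])
  have "coeff_ge
      (\<Sum>p\<in>lab (mu \<union> nu) (alpha \<union> beta) \<times> lab (mu \<inter> nu) (alpha \<inter> beta). W p)
      (\<Sum>p\<in>lab mu alpha \<times> lab nu beta. W p)"
  proof (rule coeff_ge_sum_inj[OF _ \<phi>(1,2)])
    show "finite (lab (mu \<union> nu) (alpha \<union> beta) \<times> lab (mu \<inter> nu) (alpha \<inter> beta))"
      using fin unfolding lab_def X_def by (simp add: finite_labelings)
    show "monomial (W p)" for p
      unfolding W_def e_def extend_weight_def
      by (intro monomial_prod monomial_mult) (auto simp: monomial_one w)
    show "W (\<phi> p) = W p" if p: "p \<in> lab mu alpha \<times> lab nu beta" for p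
      unfolding W_def
    proof (rule prod.cong)
      fix x assume "x \<in> X"
      then show "e x (fst (\<phi> p) x) * e x (snd (\<phi> p) x) = e x (fst p x) * e x (snd p x)"
        using same_lo_hi_cases[of "\<phi> p" x p] \<phi>(3) p by (auto simp: mult.commute)
    qed simp
  qed
  moreover have "G ((mu \<union> nu) - (alpha \<union> beta)) * G ((mu \<inter> nu) - (alpha \<inter> beta)) =
      (\<Sum>p\<in>lab (mu \<union> nu) (alpha \<union> beta) \<times> lab (mu \<inter> nu) (alpha \<inter> beta). W p)"
    by (rule G) (use down sub in \<open>unfold X_def down_closed_in_def, blast+\<close>)
  moreover have "G (mu - alpha) * G (nu - beta) = (\<Sum>p\<in>lab mu alpha \<times> lab nu beta. W p)"
    by (rule G) (use down sub in \<open>unfold X_def, blast+\<close>)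
  ultimately show ?thesis by simp
qed

section \<open>Young diagrams\<close>

lemma finite_young_diagram:
  assumes "young_diagram D" shows "finite D"
proof -
  obtain l where l: "is_partition l" "D = diagram l"
    using assms unfolding young_diagram_def by blast
  have "D \<subseteq> (SIGMA i:{i. 1 \<le> i \<and> l i \<noteq> 0}. {..l i})"
    unfolding l(2) diagram_def by auto
  then show ?thesis
    by (rule finite_subset) (use l(1) in \<open>auto simp: is_partition_def\<close>)
qed

lemma young_diagram_pos:
  "young_diagram D \<Longrightarrow> (i, j) \<in> D \<Longrightarrow> 1 \<le> i \<and> 1 \<le> j"
  unfolding young_diagram_def diagram_def by auto

text \<open>Row and column indices start at 1, so a diagram is a lower set only among squares with
  positive indices.\<close>

lemma young_diagram_down_closed:
  assumes "young_diagram D" and pos: "\<And>i j. (i, j) \<in> X \<Longrightarrow> 1 \<le> i \<and> 1 \<le> j"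
  shows "down_closed_in X D"
proof -
  obtain l where l: "is_partition l" "D = diagram l"
    using assms(1) unfolding young_diagram_def by blast
  have "(i, j) \<in> D" if "(i, j) \<in> X" "(i', j') \<in> D" "i \<le> i'" "j \<le> j'" for i j i' j'
  proof -
    have "1 \<le> i" "1 \<le> j" using pos that(1) by auto
    moreover have "l i' \<le> l i" using l(1) \<open>1 \<le> i\<close> that(3) unfolding is_partition_def by blast
    ultimately show ?thesis using that unfolding l(2) diagram_def by auto
  qed
  then show ?thesis unfolding down_closed_in_def cell_le_def by auto
qed

theorem corollary4p11:
  fixes mu nu alpha beta :: "(nat \<times> nat) set" and t N :: nat
  assumes "skew_diagram mu alpha" and "skew_diagram nu beta"
  shows "coeff_ge
      (Omega ((mu \<union> nu) - (alpha \<union> beta)) t * Omega ((mu \<inter> nu) - (alpha \<inter> beta)) t)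
      (Omega (mu - alpha) t * Omega (nu - beta) t)
    \<and> coeff_ge
      (F_poly ((mu \<union> nu) - (alpha \<union> beta)) N * F_poly ((mu \<inter> nu) - (alpha \<inter> beta)) N)
      (F_poly (mu - alpha) N * F_poly (nu - beta) N)"
proof -
  have young: "young_diagram mu" "young_diagram alpha" "young_diagram nu" "young_diagram beta"
    and sub: "alpha \<subseteq> mu" "beta \<subseteq> nu"
    using assms unfolding skew_diagram_def by auto
  have fin: "finite mu" "finite nu" using finite_young_diagram young by auto
  then have fin_union: "finite (mu \<union> nu)" by simp
  have pos: "1 \<le> i \<and> 1 \<le> j" if "(i, j) \<in> mu \<union> nu" for i j
    using that young_diagram_pos[OF young(1)] young_diagram_pos[OF young(3)] by blast
  have down: "down_closed_in (mu \<union> nu) mu" "down_closed_in (mu \<union> nu) alpha"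
      "down_closed_in (mu \<union> nu) nu" "down_closed_in (mu \<union> nu) beta"
    by (rule young_diagram_down_closed; use young pos in blast)+
  note main = coeff_ge_RPP_join_meet[OF fin_union sub down]
  show ?thesis
    using main[of "\<lambda>x v. var x ^ v" t, OF monomial_var_power]
      main[of "\<lambda>x v. var v" N, OF monomial_var] fin
    by (simp add: Omega_def F_poly_eq_sum_prod)
qed

end
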